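(* Let $G$ be a finite simple undirected graph of order $n\ge 3$ with degree sequence $d_1\le d_2\le\ldots\le d_n$ and minimum degree $\delta=d_1$, where $1\le\delta\le n-2$ (so that the terms $d_\delta$, $d_{\delta+1}$, $d_{\delta+2}$ are defined). If $\min\{d_\delta+d_{\delta+2},\,2d_{\delta+1}\}\ge n$, then $G$ is Hamiltonian.
   Context: Graphs are finite and undirected, with neither loops nor multiple edges. The order $n$ of $G$ is its number of vertices. The degree sequence $d_1\le d_2\le\ldots\le d_n$ lists the degrees of all $n$ vertices of $G$ in nondecreasing order, indexed from $1$; its first term $d_1$ is the minimum degree of $G$, denoted $\delta$. Thus $d_\delta$, $d_{\delta+1}$, $d_{\delta+2}$ are the $\delta$-th, $(\delta+1)$-th and $(\delta+2)$-th terms of this sequence. A graph is Hamiltonian if it contains a Hamilton cycle, that is, a simple spanning cycle. *)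

theory Defs
  imports "Graph_Theory.Graph_Theory" "HOL-Library.Multiset"
begin

text \<open>
  A finite simple undirected graph is an instance of the locale \<^locale>\<open>graph\<close>: a finite
  symmetric digraph without loops and without parallel arcs, each undirected edge being
  represented by its two opposite arcs. The degree of a vertex is therefore its
  \<^const>\<open>out_degree\<close> (equivalently, its \<^const>\<open>in_degree\<close>).
\<close>

definition degree_sequence :: "('a, 'b) pre_digraph \<Rightarrow> nat list" where
  "degree_sequence G = sorted_list_of_multiset (image_mset (out_degree G) (mset_set (verts G)))"

text \<open>Terms are numbered from \<open>1\<close>; only the values for \<open>1 \<le> i \<le> card (verts G)\<close> are meaningful.\<close>

definition degree_term :: "('a, 'b) pre_digraph \<Rightarrow> nat \<Rightarrow> nat" where
  "degree_term G i = degree_sequence G ! (i - 1)"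

text \<open>
  In a symmetric digraph \<^const>\<open>pre_digraph.cycle\<close> also admits the closed walk \<open>u, v, u\<close> along a
  single undirected edge; the bound on the length excludes it. The vertices of a closed walk are
  exactly the tails of its arcs.
\<close>

definition hamilton_cycle :: "('a, 'b) pre_digraph \<Rightarrow> 'b list \<Rightarrow> bool" where
  "hamilton_cycle G p \<longleftrightarrow>
     pre_digraph.cycle G p \<and> 3 \<le> length p \<and> tail G ` set p = verts G"

definition hamiltonian :: "('a, 'b) pre_digraph \<Rightarrow> bool" where
  "hamiltonian G \<longleftrightarrow> (\<exists>p. hamilton_cycle G p)"

lemma length_degree_sequence [simp]: "length (degree_sequence G) = card (verts G)"
  unfolding degree_sequence_def
  by (metis mset_sorted_list_of_multiset size_image_mset size_mset size_mset_set)

lemma sorted_degree_sequence: "sorted (degree_sequence G)"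
  unfolding degree_sequence_def by (rule sorted_sorted_list_of_multiset)

lemma set_degree_sequence:
  "finite (verts G) \<Longrightarrow> set (degree_sequence G) = out_degree G ` verts G"
  unfolding degree_sequence_def by simp

lemma degree_term_1_eq_Min:
  assumes "finite (verts G)" "verts G \<noteq> {}"
  shows "degree_term G 1 = Min (out_degree G ` verts G)"
proof -
  have ne: "degree_sequence G \<noteq> []"
    using assms by (metis card_eq_0_iff length_degree_sequence list.size(3))
  then obtain x xs where eq: "degree_sequence G = x # xs" by (cases "degree_sequence G") auto
  have "Min (set (x # xs)) = x"
    using sorted_degree_sequence[of G] unfolding eq by (intro Min_eqI) auto
  then show ?thesis
    using set_degree_sequence[OF assms(1)] unfolding degree_term_def eq by simp
qed

end

theory Submission
  imports Defs
begin

text \<open>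
  The hypothesis implies Chvatal's condition. If \<open>d k \<le> k < n/2\<close>, then \<open>2 * d (\<delta> + 1) \<ge> n\<close> forces
  \<open>k = \<delta>\<close>, hence \<open>d \<delta> = \<delta>\<close> and \<open>d (\<delta> + 2) \<ge> n - \<delta>\<close>. So \<open>d (n - \<delta>) \<ge> n - \<delta>\<close> when
  \<open>n - \<delta> \<ge> \<delta> + 2\<close>, and otherwise \<open>n = 2 * \<delta> + 1\<close> and \<open>d (\<delta> + 1) \<ge> \<delta> + 1 = n - \<delta>\<close>.

  Chvatal's theorem itself is obtained from an edge-maximal non-Hamiltonian supergraph: among its
  nonadjacent pairs choose \<open>u, v\<close> with the largest degree sum. Adding the edge \<open>uv\<close> gives a
  Hamilton path from \<open>u\<close> to \<open>v\<close>, and Ore's crossing argument bounds the degree sum by \<open>n - 1\<close>.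
\<close>

section \<open>Hamilton paths and cycles of a relation\<close>

text \<open>Vertex lists over a relation let edges be inserted and paths be cut, reversed and glued
  without naming arcs.\<close>

definition hamilton_path_on :: "'a set \<Rightarrow> 'a rel \<Rightarrow> 'a list \<Rightarrow> bool" where
  "hamilton_path_on V E xs \<longleftrightarrow>
     distinct xs \<and> set xs = V \<and> successively (\<lambda>x y. (x, y) \<in> E) xs"

text \<open>For symmetric \<open>E\<close>, two adjacent vertices also satisfy this, so a genuine
  cycle is read off only under \<open>card V \<ge> 3\<close>.\<close>

definition hamilton_cycle_on :: "'a set \<Rightarrow> 'a rel \<Rightarrow> 'a list \<Rightarrow> bool" where
  "hamilton_cycle_on V E xs \<longleftrightarrow> hamilton_path_on V E xs \<and> (last xs, hd xs) \<in> E"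

lemma hamilton_path_on_rev:
  assumes "sym E" "hamilton_path_on V E xs"
  shows "hamilton_path_on V E (rev xs)"
proof -
  have "successively (\<lambda>x y. (y, x) \<in> E) xs"
    using assms unfolding hamilton_path_on_def by (blast intro: successively_mono symD)
  then show ?thesis
    using assms(2) unfolding hamilton_path_on_def by simp
qed

lemma not_successively_split:
  assumes "\<not> successively P xs"
  obtains as bs where "xs = as @ bs" "as \<noteq> []" "bs \<noteq> []" "\<not> P (last as) (hd bs)"
proof -
  obtain i where i: "Suc i < length xs" "\<not> P (xs ! i) (xs ! Suc i)"
    using assms unfolding successively_conv_nth by blast
  show thesis
  proof (rule that[of "take (Suc i) xs" "drop (Suc i) xs"])
    show "\<not> P (last (take (Suc i) xs)) (hd (drop (Suc i) xs))"
      using i by (simp add: take_Suc_conv_app_nth hd_drop_conv_nth)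
  qed (use i in auto)
qed

text \<open>A cycle of \<open>F\<close> that is not one of \<open>E\<close> takes some step outside
  \<open>E\<close>. Cutting there and swapping the two pieces makes it the closing step.\<close>

lemma hamilton_cycle_on_rotate_to_missing_edge:
  assumes "hamilton_cycle_on V F xs" "\<not> hamilton_cycle_on V E xs"
  obtains ys where "hamilton_cycle_on V F ys" "(last ys, hd ys) \<notin> E"
proof (cases "successively (\<lambda>x y. (x, y) \<in> E) xs")
  case True
  then show thesis
    using assms that[of xs] unfolding hamilton_cycle_on_def hamilton_path_on_def by blast
next
  case False
  then obtain as bs where s: "xs = as @ bs" "as \<noteq> []" "bs \<noteq> []" "(last as, hd bs) \<notin> E"
    by (rule not_successively_split)
  have "hamilton_cycle_on V F (bs @ as)"
    using assms(1) s(1-3)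
    unfolding hamilton_cycle_on_def hamilton_path_on_def
    by (auto simp: successively_append_iff)
  then show thesis
    using that[of "bs @ as"] s by simp
qed

text \<open>In a list of at least three distinct vertices the two ends are not consecutive, so no
  step of the path can join \<open>u\<close> and \<open>v\<close>.\<close>

lemma hamilton_path_on_del_closing_edge:
  assumes "hamilton_path_on V (insert (u, v) (insert (v, u) E)) xs"
    and "{hd xs, last xs} = {u, v}" and "length xs \<ge> 3"
  shows "hamilton_path_on V E xs"
proof -
  have dist: "distinct xs" and ne: "xs \<noteq> []"
    using assms unfolding hamilton_path_on_def by auto
  have "(xs ! i, xs ! Suc i) \<in> E" if i: "Suc i < length xs" for i
  proof (rule ccontr)
    assume "(xs ! i, xs ! Suc i) \<notin> E"
    then have "{xs ! i, xs ! Suc i} = {u, v}"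
      using assms(1) i unfolding hamilton_path_on_def successively_conv_nth by blast
    then have "{xs ! i, xs ! Suc i} = {xs ! 0, xs ! (length xs - 1)}"
      using assms(2) ne by (simp add: hd_conv_nth last_conv_nth)
    then have "(i = 0 \<and> Suc i = length xs - 1) \<or> (i = length xs - 1 \<and> Suc i = 0)"
      using dist i ne by (auto simp: doubleton_eq_iff nth_eq_iff_index_eq)
    then show False
      using assms(3) by auto
  qed
  then show ?thesis
    using assms(1) unfolding hamilton_path_on_def successively_conv_nth by blast
qed

text \<open>A Hamilton cycle created by the new edge must use it. Rotated so that this edge closes
  it, its other steps lie in \<open>E\<close>; reversal fixes the direction.\<close>

lemma hamilton_path_on_if_cycle_insert:
  assumes "sym E" "card V \<ge> 3"
    and cyc: "hamilton_cycle_on V (insert (u, v) (insert (v, u) E)) xs"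
    and no: "\<nexists>xs. hamilton_cycle_on V E xs"
  obtains ys where "hamilton_path_on V E ys" "hd ys = u" "last ys = v"
proof -
  let ?F = "insert (u, v) (insert (v, u) E)"
  have "\<not> hamilton_cycle_on V E xs"
    using no by blast
  with cyc obtain ys where ys: "hamilton_cycle_on V ?F ys" "(last ys, hd ys) \<notin> E"
    by (rule hamilton_cycle_on_rotate_to_missing_edge)
  have "length ys = card V"
    using ys(1) unfolding hamilton_cycle_on_def hamilton_path_on_def
    by (metis distinct_card)
  then have len: "length ys \<ge> 3"
    using assms(2) by simp
  have ends: "(last ys, hd ys) = (u, v) \<or> (last ys, hd ys) = (v, u)"
    using ys unfolding hamilton_cycle_on_def by blast
  have p: "hamilton_path_on V E ys"
  proof (rule hamilton_path_on_del_closing_edge[OF _ _ len])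
    show "hamilton_path_on V ?F ys"
      using ys(1) unfolding hamilton_cycle_on_def by blast
    show "{hd ys, last ys} = {u, v}"
      using ends by auto
  qed
  from ends show thesis
  proof
    assume "(last ys, hd ys) = (u, v)"
    then show thesis
      using that[OF hamilton_path_on_rev[OF \<open>sym E\<close> p]] by (simp add: hd_rev last_rev)
  next
    assume "(last ys, hd ys) = (v, u)"
    then show thesis
      using that[OF p] by simp
  qed
qed

text \<open>Follow \<open>as\<close>, jump to the end of \<open>bs\<close>, run \<open>bs\<close>
  backwards and close from \<open>hd bs\<close> to \<open>hd as\<close>: two chords replace the edge
  between the pieces.\<close>

lemma hamilton_cycle_on_crossing:
  assumes "sym E" "hamilton_path_on V E (as @ bs)" "as \<noteq> []" "bs \<noteq> []"
    and "(hd as, hd bs) \<in> E" "(last as, last bs) \<in> E"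
  shows "hamilton_cycle_on V E (as @ rev bs)"
proof -
  have "successively (\<lambda>x y. (y, x) \<in> E) bs"
    using assms(1,2) unfolding hamilton_path_on_def successively_append_iff
    by (blast intro: successively_mono symD)
  then show ?thesis
    using assms unfolding hamilton_cycle_on_def hamilton_path_on_def
    by (auto simp: successively_append_iff hd_rev last_rev dest: symD)
qed

text \<open>Ore's count: a path edge crossed by chords from both ends would give a Hamilton cycle.
  So the neighbours of the two ends are counted by disjoint sets of the \<open>card V - 1\<close>
  path edges.\<close>

lemma degree_sum_less_if_hamilton_path_on:
  assumes "E \<subseteq> V \<times> V" "sym E" "irrefl E"
    and path: "hamilton_path_on V E xs" and ne: "xs \<noteq> []"
    and no: "\<nexists>xs. hamilton_cycle_on V E xs"
  shows "card (E `` {hd xs}) + card (E `` {last xs}) < card V"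
proof -
  \<comment> \<open>Index \<open>i < m\<close> stands for the path edge from \<open>xs ! i\<close>
    to \<open>xs ! Suc i\<close>; neighbours of \<open>hd xs\<close> are recorded at its far end,
    those of \<open>last xs\<close> at its near end.\<close>
  define m where "m = length xs - 1"
  define S where "S = {i. i < m \<and> (hd xs, xs ! Suc i) \<in> E}"
  define T where "T = {i. i < m \<and> (xs ! i, last xs) \<in> E}"
  have dist: "distinct xs" and V: "set xs = V"
    using path unfolding hamilton_path_on_def by auto
  have len: "length xs = Suc m" "card V = Suc m"
    using ne distinct_card[OF dist] V by (auto simp: m_def)
  have "E `` {hd xs} \<subseteq> (\<lambda>i. xs ! Suc i) ` S"
  proof
    fix y assume "y \<in> E `` {hd xs}"
    then have y: "(hd xs, y) \<in> E" by simp
    then obtain j where j: "j < length xs" "y = xs ! j"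
      using assms(1) V by (metis SigmaD2 in_set_conv_nth subsetD)
    \<comment> \<open>By irreflexivity the first vertex is not its own neighbour, so each of its
      neighbours has a predecessor on the path.\<close>
    have "j \<noteq> 0"
      using y j \<open>irrefl E\<close> ne by (metis hd_conv_nth irreflD)
    then obtain i where "j = Suc i" by (cases j) auto
    then show "y \<in> (\<lambda>i. xs ! Suc i) ` S"
      using y j len by (auto simp: S_def)
  qed
  then have S: "card (E `` {hd xs}) \<le> card S"
    by (rule surj_card_le[rotated]) (simp add: S_def)
  have "E `` {last xs} \<subseteq> (\<lambda>i. xs ! i) ` T"
  proof
    fix y assume "y \<in> E `` {last xs}"
    then have y: "(last xs, y) \<in> E" by simp
    then obtain j where j: "j < length xs" "y = xs ! j"
      using assms(1) V by (metis SigmaD2 in_set_conv_nth subsetD)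
    have "j \<noteq> m"
      using y j \<open>irrefl E\<close> ne len by (auto simp: last_conv_nth irrefl_def)
    then show "y \<in> (\<lambda>i. xs ! i) ` T"
      using y j len \<open>sym E\<close> by (auto simp: T_def dest: symD)
  qed
  then have T: "card (E `` {last xs}) \<le> card T"
    by (rule surj_card_le[rotated]) (simp add: T_def)
  have "S \<inter> T = {}"
  proof (rule ccontr)
    assume "S \<inter> T \<noteq> {}"
    then obtain i where i: "i < m" "(hd xs, xs ! Suc i) \<in> E" "(xs ! i, last xs) \<in> E"
      by (auto simp: S_def T_def)
    let ?as = "take (Suc i) xs" and ?bs = "drop (Suc i) xs"
    have "hamilton_cycle_on V E (?as @ rev ?bs)"
    proof (rule hamilton_cycle_on_crossing[OF \<open>sym E\<close>])
      show "(last ?as, last ?bs) \<in> E"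
        using i len by (simp add: take_Suc_conv_app_nth)
      show "(hd ?as, hd ?bs) \<in> E"
        using i len by (simp add: hd_drop_conv_nth)
    qed (use path i len in auto)
    with no show False by blast
  qed
  moreover have "S \<union> T \<subseteq> {..<m}"
    by (auto simp: S_def T_def)
  ultimately have "card S + card T \<le> m"
    by (metis card_Un_disjoint card_lessThan card_mono finite_Un finite_lessThan finite_subset)
  with S T len show ?thesis by simp
qed

lemma hamilton_cycle_on_complete:
  assumes "finite V" "card V \<ge> 2"
    and "\<And>x y. x \<in> V \<Longrightarrow> y \<in> V \<Longrightarrow> x \<noteq> y \<Longrightarrow> (x, y) \<in> E"
  shows "\<exists>xs. hamilton_cycle_on V E xs"
proof -
  obtain xs where xs: "set xs = V" "distinct xs"
    using finite_distinct_list[OF \<open>finite V\<close>] by blast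
  then have len: "length xs \<ge> 2"
    using assms(2) distinct_card by metis
  have "successively (\<lambda>x y. (x, y) \<in> E) xs"
    unfolding successively_conv_nth
    using xs assms(3) by (auto simp: nth_eq_iff_index_eq)
  moreover have "last xs \<noteq> hd xs" "xs \<noteq> []"
    using xs(2) len by (cases xs; auto)+
  then have "(last xs, hd xs) \<in> E"
    using assms(3) unfolding xs(1)[symmetric] by simp
  ultimately show ?thesis
    using xs unfolding hamilton_cycle_on_def hamilton_path_on_def by blast
qed

section \<open>Chvatal's theorem\<close>

text \<open>The witness \<open>k\<close> is the degree of \<open>u\<close>, the end of smaller
  degree in a nonadjacent pair \<open>u\<close>, \<open>v\<close> of largest degree sum. By this
  choice the other non-neighbours of \<open>v\<close> have degree at most \<open>k\<close>, and the
  non-neighbours of \<open>u\<close> have degree at most that of \<open>v\<close>, which is below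
  \<open>card V - k\<close>.\<close>

lemma maximal_non_hamiltonian_degrees:
  assumes "finite V" "card V \<ge> 3" "E \<subseteq> V \<times> V" "sym E" "irrefl E"
    and no: "\<nexists>xs. hamilton_cycle_on V E xs"
    and maximal: "\<And>u v. u \<in> V \<Longrightarrow> v \<in> V \<Longrightarrow> u \<noteq> v \<Longrightarrow> (u, v) \<notin> E \<Longrightarrow>
        \<exists>xs. hamilton_cycle_on V (insert (u, v) (insert (v, u) E)) xs"
  obtains k where "1 \<le> k" "2 * k < card V"
    "k \<le> card {x \<in> V. card (E `` {x}) \<le> k}"
    "card V - k \<le> card {x \<in> V. card (E `` {x}) < card V - k}"
proof -
  let ?d = "\<lambda>x. card (E `` {x})"
  let ?n = "card V"
  let ?P = "\<lambda>q. fst q \<in> V \<and> snd q \<in> V \<and> fst q \<noteq> snd q \<and> q \<notin> E"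
  let ?f = "\<lambda>q. ?d (fst q) + ?d (snd q)"
  have sub: "E `` {x} \<subseteq> V" for x
    using assms(3) by auto
  have fin: "finite (E `` {x})" for x
    using sub \<open>finite V\<close> finite_subset by blast
  have le: "?d x \<le> ?n" for x
    using sub \<open>finite V\<close> by (intro card_mono)
  have "\<exists>q. ?P q"
  proof (rule ccontr)
    assume "\<nexists>q. ?P q"
    then have "(x, y) \<in> E" if "x \<in> V" "y \<in> V" "x \<noteq> y" for x y
      using that by (metis fst_conv snd_conv)
    then show False
      using hamilton_cycle_on_complete[OF \<open>finite V\<close>, of E] no assms(2) by simp
  qed
  then obtain q0 where "?P q0" ..
  \<comment> \<open>A uniform bound on the degree sums guarantees that a greatest one is
    attained.\<close>
  moreover have "\<forall>q. ?P q \<longrightarrow> ?f q < Suc (?n + ?n)"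
    using le by (simp add: add_mono less_Suc_eq_le)
  ultimately have "\<exists>q. ?P q \<and> (\<forall>q'. ?P q' \<longrightarrow> ?f q' \<le> ?f q)"
    by (rule ex_has_greatest_nat)
  then obtain q where q: "?P q" "\<forall>q'. ?P q' \<longrightarrow> ?f q' \<le> ?f q"
    by (elim exE conjE) (intro that conjI; assumption)
  define u v where "u = (if ?d (fst q) \<le> ?d (snd q) then fst q else snd q)"
    and "v = (if ?d (fst q) \<le> ?d (snd q) then snd q else fst q)"
  have uv: "u \<in> V" "v \<in> V" "u \<noteq> v" "(u, v) \<notin> E" "(v, u) \<notin> E" "?d u \<le> ?d v"
    using q(1) symD[OF \<open>sym E\<close>, of "snd q" "fst q"] by (auto simp: u_def v_def)
  have max: "?d x + ?d y \<le> ?d u + ?d v" if "x \<in> V" "y \<in> V" "x \<noteq> y" "(x, y) \<notin> E" for x y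
  proof -
    have "?d x + ?d y \<le> ?f q"
      using q(2)[rule_format, of "(x, y)"] that by simp
    then show ?thesis by (simp add: u_def v_def)
  qed
  obtain zs where "hamilton_cycle_on V (insert (u, v) (insert (v, u) E)) zs"
    using maximal[OF uv(1-4)] by blast
  from this no obtain xs where xs: "hamilton_path_on V E xs" "hd xs = u" "last xs = v"
    by (rule hamilton_path_on_if_cycle_insert[OF \<open>sym E\<close> assms(2)])
  have len: "length xs = ?n"
    using xs(1) distinct_card unfolding hamilton_path_on_def by metis
  then have ne: "xs \<noteq> []" using assms(2) by auto
  have sum: "?d u + ?d v < ?n"
    using degree_sum_less_if_hamilton_path_on[OF assms(3-5) xs(1) ne no] xs by simp
  \<comment> \<open>The Hamilton path gives \<open>u\<close> a neighbour, so the witness is at least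
    1.\<close>
  have "xs ! Suc 0 \<in> E `` {u}"
    using xs(1) xs(2)[symmetric] len assms(2) ne
    unfolding hamilton_path_on_def successively_conv_nth by (simp add: hd_conv_nth)
  then have k1: "1 \<le> ?d u"
    using fin[of u] card_gt_0_iff[of "E `` {u}"] by auto
  \<comment> \<open>\<open>v\<close> is removed as well: \<open>max\<close> compares distinct
    vertices only, and \<open>v\<close> may have larger degree than \<open>u\<close>.\<close>
  have "card (V - insert v (E `` {v})) = ?n - Suc (?d v)"
    using card_Diff_subset[of "insert v (E `` {v})" V] uv sub fin \<open>irrefl E\<close>
    by (auto simp: irrefl_def)
  moreover have "V - insert v (E `` {v}) \<subseteq> {x \<in> V. ?d x \<le> ?d u}"
  proof
    fix x assume x: "x \<in> V - insert v (E `` {v})"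
    then have "?d v + ?d x \<le> ?d u + ?d v"
      using max[of v x] uv by auto
    then show "x \<in> {x \<in> V. ?d x \<le> ?d u}"
      using x by simp
  qed
  then have "card (V - insert v (E `` {v})) \<le> card {x \<in> V. ?d x \<le> ?d u}"
    using \<open>finite V\<close> by (intro card_mono) auto
  ultimately have low: "?n - Suc (?d v) \<le> card {x \<in> V. ?d x \<le> ?d u}"
    by simp
  \<comment> \<open>Here \<open>u\<close> may stay, since its degree is at most that of
    \<open>v\<close>.\<close>
  have "V - E `` {u} \<subseteq> {x \<in> V. ?d x < ?n - ?d u}"
  proof
    fix x assume x: "x \<in> V - E `` {u}"
    then have "x \<noteq> u \<Longrightarrow> ?d u + ?d x \<le> ?d u + ?d v"
      using max[of u x] uv by auto
    then show "x \<in> {x \<in> V. ?d x < ?n - ?d u}"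
      using x sum uv(6) by (cases "x = u") auto
  qed
  then have "card (V - E `` {u}) \<le> card {x \<in> V. ?d x < ?n - ?d u}"
    using \<open>finite V\<close> by (intro card_mono) auto
  then have "?n - ?d u \<le> card {x \<in> V. ?d x < ?n - ?d u}"
    using card_Diff_subset[OF fin sub] by metis
  moreover have "2 * ?d u < ?n" "?d u \<le> card {x \<in> V. ?d x \<le> ?d u}"
    using sum uv(6) low by linarith+
  ultimately show thesis
    using that[of "?d u"] k1 by blast
qed

text \<open>In a maximal non-Hamiltonian supergraph \<open>F\<close> on the same vertices degrees
  are at least those in \<open>E\<close>, so both counts of low-degree vertices can only grow on
  return to \<open>E\<close>.\<close>

lemma non_hamiltonian_degrees:
  assumes "finite V" "card V \<ge> 3" "E \<subseteq> V \<times> V" "sym E" "irrefl E"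
    and no: "\<nexists>xs. hamilton_cycle_on V E xs"
  obtains k where "1 \<le> k" "2 * k < card V"
    "k \<le> card {x \<in> V. card (E `` {x}) \<le> k}"
    "card V - k \<le> card {x \<in> V. card (E `` {x}) < card V - k}"
proof -
  let ?A = "{F. F \<subseteq> V \<times> V \<and> sym F \<and> irrefl F \<and> (\<nexists>xs. hamilton_cycle_on V F xs)}"
  have "finite ?A"
    using \<open>finite V\<close> by (intro finite_subset[of ?A "Pow (V \<times> V)"]) auto
  moreover have "E \<in> ?A"
    using assms by blast
  ultimately have "\<exists>F\<in>?A. E \<subseteq> F \<and> (\<forall>F'\<in>?A. F \<subseteq> F' \<longrightarrow> F = F')"
    by (rule finite_has_maximal2)
  then obtain F where F: "F \<in> ?A" "E \<subseteq> F" "\<And>F'. F' \<in> ?A \<Longrightarrow> F \<subseteq> F' \<Longrightarrow> F = F'"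
    by meson
  have maximal: "\<exists>xs. hamilton_cycle_on V (insert (u, v) (insert (v, u) F)) xs"
    if "u \<in> V" "v \<in> V" "u \<noteq> v" "(u, v) \<notin> F" for u v
  proof (rule ccontr)
    assume "\<nexists>xs. hamilton_cycle_on V (insert (u, v) (insert (v, u) F)) xs"
    moreover have "sym (insert (u, v) (insert (v, u) F))"
      using F(1) by (auto simp: sym_def)
    ultimately have "insert (u, v) (insert (v, u) F) \<in> ?A"
      using F(1) that by (auto simp: irrefl_def)
    with F(3)[of "insert (u, v) (insert (v, u) F)"] that show False by blast
  qed
  have nonham: "F \<subseteq> V \<times> V" "sym F" "irrefl F" "\<nexists>xs. hamilton_cycle_on V F xs"
    using F(1) by auto
  obtain k where k: "1 \<le> k" "2 * k < card V"
    "k \<le> card {x \<in> V. card (F `` {x}) \<le> k}"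
    "card V - k \<le> card {x \<in> V. card (F `` {x}) < card V - k}"
    by (rule maximal_non_hamiltonian_degrees[OF assms(1,2) nonham maximal])
  have deg: "card (E `` {x}) \<le> card (F `` {x})" for x
    using F(1,2) finite_subset[OF _ \<open>finite V\<close>, of "F `` {x}"] by (intro card_mono) auto
  have "card {x \<in> V. card (F `` {x}) \<le> k} \<le> card {x \<in> V. card (E `` {x}) \<le> k}"
    using \<open>finite V\<close> by (intro card_mono) (auto intro: order_trans[OF deg])
  moreover have "card {x \<in> V. card (F `` {x}) < card V - k}
      \<le> card {x \<in> V. card (E `` {x}) < card V - k}"
    using \<open>finite V\<close> by (intro card_mono) (auto intro: order_le_less_trans[OF deg])
  ultimately show thesis
    using that[of k] k by linarith
qed

section \<open>From the adjacency relation back to walks and degrees of the graph\<close>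

lemma (in wf_digraph) awalk_of_vertex_list:
  assumes "xs \<noteq> []" "set xs \<subseteq> verts G" "successively (\<lambda>x y. (x, y) \<in> arcs_ends G) xs"
  shows "\<exists>p. awalk (hd xs) p (last xs) \<and> awalk_verts (hd xs) p = xs"
  using assms
proof (induction xs rule: induct_list012)
  case (2 x)
  then show ?case by (intro exI[of _ "[]"]) (simp add: awalk_Nil_iff)
next
  case (3 x y zs)
  then obtain p where p: "awalk y p (last (y # zs))" "awalk_verts y p = y # zs"
    by auto
  from 3 obtain e where "e \<in> arcs G" "tail G e = x" "head G e = y"
    by (auto simp: arcs_ends_conv)
  with p show ?case
    by (intro exI[of _ "e # p"]) (simp add: awalk_Cons_iff)
qed simp

text \<open>Repeating the first vertex at the end of the list yields a closed walk whose arc tails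
  are exactly the list.\<close>

lemma (in wf_digraph) hamiltonian_if_hamilton_cycle_on:
  assumes "hamilton_cycle_on (verts G) (arcs_ends G) xs" "card (verts G) \<ge> 3"
  shows "hamiltonian G"
proof -
  have xs: "distinct xs" "set xs = verts G" "successively (\<lambda>x y. (x, y) \<in> arcs_ends G) xs"
    "(last xs, hd xs) \<in> arcs_ends G"
    using assms(1) unfolding hamilton_cycle_on_def hamilton_path_on_def by auto
  then have len: "length xs \<ge> 3"
    using assms(2) distinct_card[OF xs(1)] by simp
  then have ne: "xs \<noteq> []" by auto
  have closed: "successively (\<lambda>x y. (x, y) \<in> arcs_ends G) (xs @ [hd xs])"
    using xs(3,4) unfolding successively_append_iff by simp
  have sub: "set (xs @ [hd xs]) \<subseteq> verts G"
    using hd_in_set[OF ne] xs(2) by simp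
  have "\<exists>p. awalk (hd (xs @ [hd xs])) p (last (xs @ [hd xs])) \<and>
      awalk_verts (hd (xs @ [hd xs])) p = xs @ [hd xs]"
    by (rule awalk_of_vertex_list[OF _ sub closed]) simp
  then obtain p where p: "awalk (hd xs) p (hd xs)" "awalk_verts (hd xs) p = xs @ [hd xs]"
    using ne by auto
  then have pne: "p \<noteq> []" and tails: "map (tail G) p = xs"
    using ne by (auto simp: awalk_verts_conv[of "hd xs" p] split: if_splits)
  \<comment> \<open>The start recurs at the end of a closed walk, so distinctness is asked only
    after dropping the first entry.\<close>
  have "distinct (tl (awalk_verts (hd xs) p))"
    using xs(1) ne p(2) by (cases xs) auto
  then have "cycle p"
    using p(1) pne unfolding cycle_def by blast
  moreover have "length p = length xs"
    using arg_cong[OF tails, of length] by simp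
  moreover have "tail G ` set p = verts G"
    using arg_cong[OF tails, of set] xs(2) by simp
  ultimately show ?thesis
    using len unfolding hamiltonian_def hamilton_cycle_def by auto
qed

text \<open>Without parallel arcs, an arc leaving \<open>v\<close> is determined by its
  head.\<close>

lemma (in nomulti_digraph) out_degree_eq_card_Image:
  "out_degree G v = card (arcs_ends G `` {v})"
proof -
  have "arcs_ends G `` {v} = head G ` out_arcs G v"
    by (auto simp: arcs_ends_conv out_arcs_def image_iff)
  moreover have "inj_on (head G) (out_arcs G v)"
    by (auto intro!: inj_onI no_multi_arcs simp: arc_to_ends_def)
  ultimately show ?thesis
    by (simp add: out_degree_def card_image)
qed

section \<open>Terms of the degree sequence as counts of vertices\<close>

lemma sorted_nth_le_iff:
  fixes xs :: "'a::linorder list"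
  assumes "sorted xs" "i < length xs"
  shows "xs ! i \<le> m \<longleftrightarrow> i < length (filter (\<lambda>x. x \<le> m) xs)"
  using assms
proof (induction xs arbitrary: i)
  case (Cons x xs)
  show ?case
  proof (cases "x \<le> m")
    case True
    then show ?thesis using Cons by (cases i) auto
  next
    case False
    then have "filter (\<lambda>y. y \<le> m) (x # xs) = []"
      using Cons.prems(1) by (auto simp: filter_empty_conv)
    moreover have "x \<le> (x # xs) ! i"
      using Cons.prems by (cases i) auto
    ultimately show ?thesis using False by auto
  qed
qed simp

text \<open>The terms at most \<open>m\<close> form an initial segment of the sorted sequence.
  Numbering from 1 makes the comparison with the count weak.\<close>

lemma degree_term_le_iff:
  assumes "finite (verts G)" "1 \<le> i" "i \<le> card (verts G)"
  shows "degree_term G i \<le> m \<longleftrightarrow> i \<le> card {v \<in> verts G. out_degree G v \<le> m}"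
proof -
  have "length (filter (\<lambda>x. x \<le> m) (degree_sequence G))
      = size (filter_mset (\<lambda>x. x \<le> m) (mset (degree_sequence G)))"
    by (metis mset_filter size_mset)
  also have "\<dots> = card {v \<in> verts G. out_degree G v \<le> m}"
    using assms(1) by (simp add: degree_sequence_def filter_mset_image_mset)
  finally show ?thesis
    using sorted_nth_le_iff[OF sorted_degree_sequence, of "i - 1" G m] assms(2,3)
    unfolding degree_term_def by auto
qed

text \<open>For a non-Hamiltonian graph the two vertex counts translate, for some \<open>k\<close>,
  into a \<open>k\<close>-th term at most \<open>k\<close> and an \<open>(n - k)\<close>-th term
  below \<open>n - k\<close>, contrary to \<open>cond\<close>.\<close>

theorem chvatal:
  fixes G :: "('a, 'b) pre_digraph"
  assumes "graph G" "card (verts G) \<ge> 3"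
    and cond: "\<And>k. 1 \<le> k \<Longrightarrow> 2 * k < card (verts G) \<Longrightarrow> degree_term G k \<le> k \<Longrightarrow>
        card (verts G) - k \<le> degree_term G (card (verts G) - k)"
  shows "hamiltonian G"
proof (rule ccontr)
  interpret graph G by fact
  let ?n = "card (verts G)"
  assume "\<not> hamiltonian G"
  then have no: "\<nexists>xs. hamilton_cycle_on (verts G) (arcs_ends G) xs"
    using hamiltonian_if_hamilton_cycle_on assms(2) by blast
  have "arcs_ends G \<subseteq> verts G \<times> verts G" "irrefl (arcs_ends G)"
    using no_loops by (auto simp: arcs_ends_conv irrefl_def)
  moreover have "sym (arcs_ends G)"
    using sym_arcs by (simp add: symmetric_def)
  ultimately obtain k where k: "1 \<le> k" "2 * k < ?n"
    "k \<le> card {x \<in> verts G. out_degree G x \<le> k}"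
    "?n - k \<le> card {x \<in> verts G. out_degree G x < ?n - k}"
    using non_hamiltonian_degrees[OF finite_verts assms(2) _ _ _ no]
    by (auto simp: out_degree_eq_card_Image)
  have "degree_term G k \<le> k"
    using degree_term_le_iff[of G k k] k by simp
  \<comment> \<open>Since \<open>?n - k\<close> is positive, truncated subtraction is harmless
    here.\<close>
  moreover have "(\<lambda>x. x < ?n - k) = (\<lambda>x. x \<le> ?n - k - 1)"
    using k(1,2) by auto
  then have "degree_term G (?n - k) \<le> ?n - k - 1"
    using degree_term_le_iff[of G "?n - k" "?n - k - 1"] k by (simp add: fun_eq_iff)
  ultimately show False
    using cond[OF k(1,2)] k(1,2) by linarith
qed

theorem theorem2:
  fixes G :: "('a, 'b) pre_digraph" and n \<delta> :: nat and d :: "nat \<Rightarrow> nat"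
  assumes "graph G"
    and "n = card (verts G)" and "n \<ge> 3"
    and "d = degree_term G"
    and "\<delta> = d 1" and "1 \<le> \<delta>" and "\<delta> \<le> n - 2"
    and "min (d \<delta> + d (\<delta> + 2)) (2 * d (\<delta> + 1)) \<ge> n"
  shows "hamiltonian G"
proof (rule chvatal[OF assms(1)])
  show "card (verts G) \<ge> 3" using assms by simp
  have mono: "d i \<le> d j" if "1 \<le> i" "i \<le> j" "j \<le> n" for i j
    using that assms(2) sorted_nth_mono[OF sorted_degree_sequence, of "i - 1" "j - 1" G]
    unfolding assms(4) degree_term_def by auto
  have min: "n \<le> d \<delta> + d (\<delta> + 2)" "n \<le> 2 * d (\<delta> + 1)"
    using assms(8) by auto
  fix k assume "1 \<le> k" "2 * k < card (verts G)" "degree_term G k \<le> k"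
  then have k: "1 \<le> k" "2 * k < n" "d k \<le> k"
    using assms by auto
  \<comment> \<open>\<open>\<delta> = d 1 \<le> d k \<le> k\<close>.\<close>
  have "\<delta> \<le> k"
    using mono[of 1 k] k assms(5) by simp
  \<comment> \<open>Otherwise
    \<open>2 * d (\<delta> + 1) \<le> 2 * d k \<le> 2 * k < n\<close>.\<close>
  moreover have "\<not> \<delta> + 1 \<le> k"
    using mono[of "\<delta> + 1" k] k min(2) by linarith
  ultimately have "k = \<delta>" by simp
  then have "d \<delta> \<le> \<delta>" using k(3) by simp
  have "n - \<delta> \<le> d (n - \<delta>)"
  proof (cases "\<delta> + 2 \<le> n - \<delta>")
    case True
    then show ?thesis
      using mono[of "\<delta> + 2" "n - \<delta>"] min(1) \<open>d \<delta> \<le> \<delta>\<close> by linarith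
  next
    case False
    then have "n - \<delta> = \<delta> + 1" "n = 2 * \<delta> + 1"
      using k(2) \<open>k = \<delta>\<close> by auto
    \<comment> \<open>Parity gains the missing unit:
      \<open>2 * d (\<delta> + 1) \<ge> 2 * \<delta> + 1\<close> forces
      \<open>d (\<delta> + 1) \<ge> \<delta> + 1\<close>.\<close>
    then show ?thesis
      using min(2) by auto
  qed
  then show "card (verts G) - k \<le> degree_term G (card (verts G) - k)"
    using assms(2,4) \<open>k = \<delta>\<close> by simp
qed

end
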